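(* Let $X$ be a set of $n$ points in $\mathbb{R}^2$ equipped with an $L_p$-metric $\delta$, and let $(X,\delta)$ be an $\alpha$-stable instance of the $k$-median problem for some $\alpha>5$. Then the $1$-swap local search algorithm terminates with the optimal clustering within $O(k\log(n\Delta))$ iterations, where $\Delta$ is the spread of $X$.
   Context: For a set $S=\{c_1,\dots,c_k\}$ of $k$ centers, the $k$-clustering induced by $S$ assigns each $p\in X$ to a nearest center; $\delta(p,S)=\min_{c\in S}\delta(p,c)$ and the $k$-median cost is $\$(X,S)=\sum_{p\in X}\delta(p,S)$. An optimal $k$-clustering is one induced by a $k$-point set minimizing this cost. For $\alpha\ge1$, $(X,\delta)$ is $\alpha$-stable if for every function $\tilde\delta$ (not necessarily a metric) with $\delta(p,q)\le\tilde\delta(p,q)\le\alpha\,\delta(p,q)$ for all $p,q$, every optimal clustering of $(X,\delta)$ (as a partition of $X$) is also an optimal clustering under $\tilde\delta$. The $1$-swap local search algorithm maintains a set $S\subseteq X$ of $k$ centers; at each iteration it finds $x\in X$ and $y\in S$ minimizing $\$(X,S\cup\{x\}\setminus\{y\})$; if this value is $\ge\$(X,S)$ it stops and returns the clustering induced by $S$, otherwise it replaces $S$ by $S\cup\{x\}\setminus\{y\}$ and repeats. The spread $\Delta$ of $X$ is the ratio of the largest to the smallest pairwise distance in $X$. *)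

theory Defs
  imports "HOL-Analysis.Analysis" "HOL-Library.Extended_Real"
begin

type_synonym pt = "real \<times> real"

definition lp_dist :: "ereal \<Rightarrow> pt \<Rightarrow> pt \<Rightarrow> real" where
  "lp_dist p x y =
     (if p = \<infinity> then max \<bar>fst x - fst y\<bar> \<bar>snd x - snd y\<bar>
      else (\<bar>fst x - fst y\<bar> powr (real_of_ereal p) + \<bar>snd x - snd y\<bar> powr (real_of_ereal p))
             powr (1 / real_of_ereal p))"

definition dist_to :: "('a \<Rightarrow> 'a \<Rightarrow> real) \<Rightarrow> 'a set \<Rightarrow> 'a \<Rightarrow> real" where
  "dist_to d S x = Min (d x ` S)"

definition kcost :: "('a \<Rightarrow> 'a \<Rightarrow> real) \<Rightarrow> 'a set \<Rightarrow> 'a set \<Rightarrow> real" where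
  "kcost d X S = (\<Sum>x\<in>X. dist_to d S x)"

definition opt_centers :: "('a \<Rightarrow> 'a \<Rightarrow> real) \<Rightarrow> 'a set \<Rightarrow> nat \<Rightarrow> 'a set \<Rightarrow> bool" where
  "opt_centers d X k S \<longleftrightarrow> S \<subseteq> X \<and> card S = k \<and>
     (\<forall>T. T \<subseteq> X \<and> card T = k \<longrightarrow> kcost d X S \<le> kcost d X T)"

definition induced_clusterings :: "('a \<Rightarrow> 'a \<Rightarrow> real) \<Rightarrow> 'a set \<Rightarrow> 'a set \<Rightarrow> 'a set set set" where
  "induced_clusterings d X S =
     {P. \<exists>a. (\<forall>x\<in>X. a x \<in> S \<and> d x (a x) = dist_to d S x) \<and>
            P = (\<lambda>c. {x\<in>X. a x = c}) ` S}"

definition optimal_clusterings :: "('a \<Rightarrow> 'a \<Rightarrow> real) \<Rightarrow> 'a set \<Rightarrow> nat \<Rightarrow> 'a set set set" where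
  "optimal_clusterings d X k =
     {P. \<exists>S. opt_centers d X k S \<and> P \<in> induced_clusterings d X S}"

definition stable :: "real \<Rightarrow> ('a \<Rightarrow> 'a \<Rightarrow> real) \<Rightarrow> 'a set \<Rightarrow> nat \<Rightarrow> bool" where
  "stable \<alpha> d X k \<longleftrightarrow>
     (\<forall>d'. (\<forall>x\<in>X. \<forall>y\<in>X. d x y \<le> d' x y \<and> d' x y \<le> \<alpha> * d x y) \<longrightarrow>
           optimal_clusterings d X k \<subseteq> optimal_clusterings d' X k)"

definition spread :: "('a \<Rightarrow> 'a \<Rightarrow> real) \<Rightarrow> 'a set \<Rightarrow> real" where
  "spread d X = Max {d x y | x y. x \<in> X \<and> y \<in> X \<and> x \<noteq> y} /
                Min {d x y | x y. x \<in> X \<and> y \<in> X \<and> x \<noteq> y}"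

definition swap_step :: "('a \<Rightarrow> 'a \<Rightarrow> real) \<Rightarrow> 'a set \<Rightarrow> 'a set \<Rightarrow> 'a set \<Rightarrow> bool" where
  "swap_step d X S S' \<longleftrightarrow>
     (\<exists>x\<in>X. \<exists>y\<in>S. S' = insert x (S - {y})) \<and>
     (\<forall>x\<in>X. \<forall>y\<in>S. kcost d X S' \<le> kcost d X (insert x (S - {y}))) \<and>
     kcost d X S' < kcost d X S"

definition swap_stops :: "('a \<Rightarrow> 'a \<Rightarrow> real) \<Rightarrow> 'a set \<Rightarrow> 'a set \<Rightarrow> bool" where
  "swap_stops d X S \<longleftrightarrow> (\<forall>x\<in>X. \<forall>y\<in>S. kcost d X (insert x (S - {y})) \<ge> kcost d X S)"

end

theory Submission
  imports Defs
begin

text \<open>Fix an optimal set \<open>Q\<close> of centers and the current set \<open>S\<close>. Multiplying by \<open>\<alpha>\<close> all distances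
  except those from a point to its center in \<open>S\<close> keeps the cost of \<open>S\<close>, so by stability some set
  \<open>R\<close> of centers inducing the same clusters as \<open>Q\<close> is still no worse than \<open>S\<close> after the
  perturbation. Hence the gap \<open>cost S - cost Q\<close> is at least \<open>(\<alpha> - 1) * W\<close>, where \<open>W\<close> sums the
  distance to \<open>R\<close> over the points whose centers in \<open>S\<close> and \<open>R\<close> differ. The averaging argument
  over \<open>k\<close> test swaps (insert a member of \<open>Q\<close>, but reroute the orphaned points through \<open>R\<close>) shows
  that \<open>k\<close> times the best gain is at least \<open>gap - 4 * W\<close>, that is, at least
  \<open>(\<alpha> - 5) / (\<alpha> - 1) * gap\<close>. So a local optimum is a global one, and the gap decays
  geometrically. The gap may become arbitrarily small without vanishing, but once it is below
  \<open>\<alpha> - 1\<close> times the least distance, \<open>S\<close> equals \<open>R\<close> and already induces the optimal clusters;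
  from then on each iteration settles the center of one cluster for good.\<close>

section \<open>Pairing incoming with outgoing centers\<close>

text \<open>An element with a single preimage is paired with it; an element without preimages serves at
  most two of the remaining arguments, and counting shows that these suffice.\<close>
lemma swap_pairing:
  fixes h :: "'a \<Rightarrow> 'b"
  assumes "finite A" "finite B" "card A = card B" "h ` A \<subseteq> B"
  obtains g where "\<And>x. x \<in> A \<Longrightarrow> g x \<in> B"
    and "\<And>x y. \<lbrakk>x \<in> A; y \<in> A; y \<noteq> x\<rbrakk> \<Longrightarrow> h y \<noteq> g x"
    and "\<And>z. card {x \<in> A. g x = z} \<le> 2"
proof -
  define A1 where "A1 = {x \<in> A. \<forall>y\<in>A. h y = h x \<longrightarrow> y = x}"
  define R where "R = A - A1"
  define Z where "Z = B - h ` A"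
  have fin: "finite A1" "finite R" "finite Z"
    using assms by (auto simp: A1_def R_def Z_def)
  have "inj_on h A1" by (auto simp: A1_def inj_on_def)
  then have cA1: "card (h ` A1) = card A1" by (rule card_image)
  have hA: "h ` A = h ` A1 \<union> h ` R" by (auto simp: R_def A1_def)
  have "h x \<noteq> h y" if "x \<in> A1" "y \<in> R" for x y
    using that unfolding R_def A1_def by (metis (mono_tags, lifting) DiffD1 DiffD2 mem_Collect_eq)
  then have "h ` A1 \<inter> h ` R = {}" by blast
  then have chA: "card (h ` A) = card A1 + card (h ` R)"
    using fin cA1 unfolding hA by (simp add: card_Un_disjoint)
  have fiber: "2 \<le> card {x \<in> R. h x = z}" if z: "z \<in> h ` R" for z
  proof -
    obtain x where x: "x \<in> R" "z = h x" using z by auto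
    then obtain y where y: "y \<in> A" "h y = h x" "y \<noteq> x" by (auto simp: R_def A1_def)
    with x have "y \<in> R" by (auto simp: R_def A1_def)
    then have "card {x, y} \<le> card {x \<in> R. h x = z}"
      using x y fin by (intro card_mono) auto
    then show ?thesis using y by simp
  qed
  have "2 * card (h ` R) \<le> (\<Sum>z\<in>h ` R. card {x \<in> R. h x = z})"
    using sum_mono[of "h ` R" "\<lambda>_. 2" "\<lambda>z. card {x \<in> R. h x = z}"] fiber by simp
  also have "\<dots> = card R"
    using sum.group[of R "h ` R" h "\<lambda>_. 1::nat"] fin by simp
  finally have hR: "2 * card (h ` R) \<le> card R" .
  have "A1 \<subseteq> A" by (auto simp: A1_def)
  then have "card R = card A - card A1" "card A1 \<le> card A"
    using assms(1) fin by (auto simp: R_def card_Diff_subset intro: card_mono)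
  moreover have "card Z = card B - card (h ` A)"
    using assms by (simp add: Z_def card_Diff_subset)
  ultimately have RZ: "card R \<le> 2 * card Z"
    using hR chA assms(3) by linarith
  obtain u where u: "bij_betw u R {..<card R}"
    using ex_bij_betw_finite_nat[OF fin(2)] by (auto simp: atLeast0LessThan)
  obtain v where v: "bij_betw v {..<card Z} Z"
    using ex_bij_betw_nat_finite[OF fin(3)] by (auto simp: atLeast0LessThan)
  \<comment> \<open>Number \<open>R\<close> by \<open>u\<close>; the halving lets two consecutive
    numbers share one element of \<open>Z\<close>, so no element of \<open>Z\<close> is used three
    times.\<close>
  define g where "g x = (if x \<in> A1 then h x else v (u x div 2))" for x
  have gR: "g x \<in> Z" "u x div 2 < card Z" if "x \<in> R" for x
  proof -
    have "u x < card R" using u that by (auto simp: bij_betw_def)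
    then show *: "u x div 2 < card Z" using RZ by linarith
    then show "g x \<in> Z" using v that by (auto simp: g_def R_def bij_betw_def)
  qed
  show thesis
  proof
    show "g x \<in> B" if "x \<in> A" for x
      using that gR[of x] assms(4) by (cases "x \<in> A1") (auto simp: g_def R_def Z_def)
    show "h y \<noteq> g x" if "x \<in> A" "y \<in> A" "y \<noteq> x" for x y
    proof (cases "x \<in> A1")
      case True
      then show ?thesis using that by (auto simp: g_def A1_def)
    next
      case False
      then show ?thesis using that gR(1)[of x] by (metis DiffD2 DiffI R_def Z_def imageI)
    qed
    show "card {x \<in> A. g x = z} \<le> 2" for z
    proof (cases "z \<in> Z")
      case True
      then obtain i where i: "i < card Z" "z = v i" using v by (auto simp: bij_betw_def)
      have fib: "{x \<in> A. g x = z} \<subseteq> R"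
        using True by (auto simp: R_def g_def Z_def)
      then have "inj_on u {x \<in> A. g x = z}"
        using u by (auto simp: bij_betw_def intro: inj_on_subset)
      moreover have "u x \<in> {2 * i, 2 * i + 1}" if x: "x \<in> A" "g x = z" for x
      proof -
        have "x \<in> R" using x fib by blast
        then have "v (u x div 2) = v i" "u x div 2 < card Z"
          using x i gR(2)[of x] by (auto simp: g_def R_def)
        then have "u x div 2 = i"
          using i v by (auto simp: bij_betw_def inj_on_def)
        then show ?thesis by auto
      qed
      then have "u ` {x \<in> A. g x = z} \<subseteq> {2 * i, 2 * i + 1}" by blast
      ultimately have "card {x \<in> A. g x = z} \<le> card {2 * i, 2 * i + 1}"
        by (intro card_inj_on_le) auto
      then show ?thesis by simp
    next
      \<comment> \<open>Outside \<open>Z\<close> only elements of \<open>A1\<close> are sent to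
        \<open>z\<close>, and there \<open>g\<close> is the injective \<open>h\<close>.\<close>
      case False
      have "x = y" if "x \<in> A" "y \<in> A" "g x = z" "g y = z" for x y
      proof -
        have "x \<in> A1" using that(1,3) False gR(1)[of x] by (auto simp: R_def)
        moreover have "y \<in> A1" using that(2,4) False gR(1)[of y] by (auto simp: R_def)
        ultimately have "h x = h y" using that(3,4) by (simp add: g_def)
        then show ?thesis using \<open>y \<in> A1\<close> that(1) by (auto simp: A1_def)
      qed
      then have "card {x \<in> A. g x = z} \<le> 1"
        using assms(1) by (simp add: card_le_Suc0_iff_eq)
      then show ?thesis by simp
    qed
  qed
qed

section \<open>The L_p distance on the plane is a metric\<close>

text \<open>Convexity up to the boundary: if \<open>a\<close> or \<open>b\<close> vanishes, it comes
  down to \<open>u powr r\<close> \<le> \<open>u\<close> for \<open>u\<close> between 0 and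
  1.\<close>

lemma powr_convex_combination:
  fixes a b t r :: real
  assumes "1 \<le> r" "0 \<le> a" "0 \<le> b" "0 \<le> t" "t \<le> 1"
  shows "((1 - t) * a + t * b) powr r \<le> (1 - t) * a powr r + t * b powr r"
proof -
  have scale: "(u * c) powr r \<le> u * c powr r" if "0 \<le> u" "u \<le> 1" "0 \<le> c" for u c :: real
  proof -
    have "u powr r \<le> u"
      using powr_mono'[of 1 r u] that assms(1) by (cases "u = 0") auto
    then show ?thesis using that by (simp add: powr_mult mult_right_mono)
  qed
  consider "a = 0" | "b = 0" | "0 < a" "0 < b" using assms by linarith
  then show ?thesis
  proof cases
    case 1
    then show ?thesis using scale[of t b] assms by simp
  next
    case 2
    then show ?thesis using scale[of "1 - t" a] assms by simp
  next
    case 3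
    then show ?thesis using convex_onD[OF powr_convex[OF assms(1)], of t a b] assms by simp
  qed
qed

text \<open>Scaled by their norms \<open>M\<close> and \<open>N\<close>, both vectors have norm 1.
  Their sum is \<open>M + N\<close> times a convex combination of these unit vectors, and convexity
  of the power bounds each coordinate.\<close>

lemma minkowski_two:
  fixes a b c e r :: real
  assumes r: "1 \<le> r" and nn: "0 \<le> a" "0 \<le> b" "0 \<le> c" "0 \<le> e"
  shows "((a + c) powr r + (b + e) powr r) powr (1 / r)
           \<le> (a powr r + b powr r) powr (1 / r) + (c powr r + e powr r) powr (1 / r)"
proof -
  define M where "M = (a powr r + b powr r) powr (1 / r)"
  define N where "N = (c powr r + e powr r) powr (1 / r)"
  have M: "M powr r = a powr r + b powr r" and N: "N powr r = c powr r + e powr r"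
    using r by (auto simp: M_def N_def powr_powr)
  have nonneg: "0 \<le> M" "0 \<le> N" by (auto simp: M_def N_def)
  consider "M = 0" | "N = 0" | "0 < M" "0 < N" using nonneg by linarith
  then show ?thesis
  proof cases
    case 1
    then have "a powr r + b powr r = 0" using M r by simp
    then have "a = 0" "b = 0" by (smt (verit) powr_ge_zero powr_eq_0_iff)+
    then show ?thesis using r by simp
  next
    case 2
    then have "c powr r + e powr r = 0" using N r by simp
    then have "c = 0" "e = 0" by (smt (verit) powr_ge_zero powr_eq_0_iff)+
    then show ?thesis using r by simp
  next
    case 3
    \<comment> \<open>The weight for which
      \<open>(1 - t) * (x / M) + t * (y / N) = (x + y) / (M + N)\<close>.\<close>
    define t where "t = N / (M + N)"
    have t: "0 \<le> t" "t \<le> 1" and t': "1 - t = M / (M + N)" using 3 by (auto simp: t_def field_simps)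
    have coord: "(x + y) powr r \<le> (M + N) powr r *
        ((1 - t) * (x powr r / M powr r) + t * (y powr r / N powr r))"
      if "0 \<le> x" "0 \<le> y" for x y
    proof -
      have "(1 - t) * (x / M) = x / (M + N)" "t * (y / N) = y / (M + N)"
        unfolding t' using 3 by (simp_all add: t_def)
      then have "x + y = (M + N) * ((1 - t) * (x / M) + t * (y / N))"
        using 3 by (simp flip: add_divide_distrib)
      then have "(x + y) powr r = (M + N) powr r * ((1 - t) * (x / M) + t * (y / N)) powr r"
        using 3 that t by (simp add: powr_mult)
      also have "\<dots> \<le> (M + N) powr r * ((1 - t) * (x / M) powr r + t * (y / N) powr r)"
        using powr_convex_combination[of r "x / M" "y / N" t] r t that 3
        by (intro mult_left_mono) auto
      finally show ?thesis using 3 that by (simp add: powr_divide)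
    qed
    have "(a + c) powr r + (b + e) powr r
        \<le> (M + N) powr r * ((1 - t) * ((a powr r + b powr r) / M powr r)
              + t * ((c powr r + e powr r) / N powr r))"
      using coord[of a c] coord[of b e] nn by (simp add: algebra_simps add_divide_distrib)
    also have "\<dots> = (M + N) powr r" using 3 by (simp flip: M N)
    finally have "((a + c) powr r + (b + e) powr r) powr (1 / r) \<le> ((M + N) powr r) powr (1 / r)"
      using r by (intro powr_mono2) auto
    also have "\<dots> = M + N" using 3 r by (simp add: powr_powr)
    finally show ?thesis by (simp add: M_def N_def)
  qed
qed

lemma Metric_space_lp_dist:
  assumes "1 \<le> p"
  shows "Metric_space UNIV (lp_dist p)"
proof (cases "p = \<infinity>")
  case True
  then show ?thesis by unfold_locales (auto simp: lp_dist_def prod_eq_iff max_def)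
next
  case False
  define r where "r = real_of_ereal p"
  have r: "1 \<le> r" using assms False by (cases p) (auto simp: r_def)
  have lp: "lp_dist p x y = (\<bar>fst x - fst y\<bar> powr r + \<bar>snd x - snd y\<bar> powr r) powr (1 / r)" for x y
    using False by (simp add: lp_dist_def r_def)
  show ?thesis
  proof
    fix x y z :: pt
    show "0 \<le> lp_dist p x y" by (simp add: lp)
    show "lp_dist p x y = lp_dist p y x" by (simp add: lp abs_minus_commute)
    show "lp_dist p x y = 0 \<longleftrightarrow> x = y"
      using r by (simp add: lp add_nonneg_eq_0_iff prod_eq_iff)
    have "lp_dist p x z \<le> ((\<bar>fst x - fst y\<bar> + \<bar>fst y - fst z\<bar>) powr r
        + (\<bar>snd x - snd y\<bar> + \<bar>snd y - snd z\<bar>) powr r) powr (1 / r)"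
      unfolding lp using r by (intro powr_mono2 add_mono) auto
    also have "\<dots> \<le> lp_dist p x y + lp_dist p y z"
      unfolding lp using r by (intro minkowski_two) auto
    finally show "lp_dist p x z \<le> lp_dist p x y + lp_dist p y z" .
  qed
qed

section \<open>Nearest centers and costs\<close>

text \<open>The condition on assignments in \<open>induced_clusterings\<close>: ties may be broken
  in any way, and values outside \<open>X\<close> are free.\<close>

definition nearest_map :: "('a \<Rightarrow> 'a \<Rightarrow> real) \<Rightarrow> 'a set \<Rightarrow> 'a set \<Rightarrow> ('a \<Rightarrow> 'a) \<Rightarrow> bool" where
  "nearest_map d X S s \<longleftrightarrow> (\<forall>x\<in>X. s x \<in> S \<and> d x (s x) = dist_to d S x)"

lemma dist_to_le: "finite S \<Longrightarrow> c \<in> S \<Longrightarrow> dist_to d S x \<le> d x c"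
  by (simp add: dist_to_def)

lemma nearest_map_le:
  "\<lbrakk>nearest_map d X S s; finite S; x \<in> X; c \<in> S\<rbrakk> \<Longrightarrow> d x (s x) \<le> d x c"
  by (simp add: nearest_map_def dist_to_le)

lemma kcost_nearest_map: "nearest_map d X S s \<Longrightarrow> kcost d X S = (\<Sum>x\<in>X. d x (s x))"
  by (simp add: kcost_def nearest_map_def)

lemma kcost_le:
  assumes "finite S" "\<And>x. x \<in> X \<Longrightarrow> f x \<in> S"
  shows "kcost d X S \<le> (\<Sum>x\<in>X. d x (f x))"
  unfolding kcost_def using assms by (intro sum_mono dist_to_le)

lemma nearest_map_exists:
  assumes "finite S" "S \<noteq> {}"
  obtains s where "nearest_map d X S s"
proof -
  have "\<exists>c\<in>S. d x c = dist_to d S x" for x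
    using Min_in[of "d x ` S"] assms unfolding dist_to_def by (metis finite_imageI image_iff image_is_empty)
  then show thesis using that unfolding nearest_map_def by metis
qed

locale finite_metric = Metric_space X d for X :: "'a set" and d :: "'a \<Rightarrow> 'a \<Rightarrow> real" +
  assumes finite_X: "finite X"
begin

lemma finite_centers: "S \<subseteq> X \<Longrightarrow> finite S"
  using finite_X by (rule rev_finite_subset)

text \<open>No tie can occur at a center, since any other point has positive distance from
  it.\<close>

lemma nearest_map_fix:
  assumes "nearest_map d X S s" "S \<subseteq> X" "c \<in> S"
  shows "s c = c"
proof -
  have "d c (s c) \<le> d c c" "s c \<in> X" "c \<in> X"
    using assms nearest_map_le[OF assms(1) finite_centers[OF assms(2)], of c c]
    by (auto simp: nearest_map_def)
  then show ?thesis using nonneg[of c "s c"] by (metis mdist_zero order_antisym zero)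
qed

lemma opt_centers_exists:
  assumes "k \<le> card X"
  obtains Q where "opt_centers d X k Q"
proof -
  define F where "F = {T. T \<subseteq> X \<and> card T = k}"
  have "finite F" using finite_X by (simp add: F_def)
  moreover have "F \<noteq> {}" using obtain_subset_with_card_n[OF assms] by (auto simp: F_def)
  ultimately obtain Q where "Q \<in> F" "Min (kcost d X ` F) = kcost d X Q"
    using Min_in[of "kcost d X ` F"] by (metis finite_imageI image_iff image_is_empty)
  then have "Q \<in> F" "\<forall>T\<in>F. kcost d X Q \<le> kcost d X T"
    using \<open>finite F\<close> by (metis Min_le finite_imageI imageI)+
  then show thesis using that by (auto simp: F_def opt_centers_def)
qed

lemma kcost_mono:
  assumes "S \<subseteq> T" "S \<noteq> {}" "finite T"
  shows "kcost d X T \<le> kcost d X S"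
  unfolding kcost_def dist_to_def using assms by (intro sum_mono Min_antimono) auto

section \<open>Averaging over test swaps\<close>

text \<open>A test swap brings in \<open>q\<close> and drops \<open>\<sigma> q\<close>. The points of the cluster of \<open>q\<close> move to
  \<open>q\<close>; a point \<open>x\<close> of another cluster that loses its center moves to the member of \<open>S\<close> nearest
  to \<open>b x\<close>. The triangle inequality bounds the price of the latter by \<open>2 * d x (b x)\<close>. The
  clusters of \<open>a\<close> and \<open>b\<close> coincide, but the two maps may use different centers.\<close>
lemma sum_test_swaps:
  assumes S: "S \<subseteq> X" "card S = card Q" "nearest_map d X S s"
    and Q: "Q \<subseteq> X" "\<And>x. x \<in> X \<Longrightarrow> a x \<in> Q"
    and b: "\<And>x. x \<in> X \<Longrightarrow> b x \<in> X" "\<And>x. x \<in> X \<Longrightarrow> b (a x) = b x"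
  obtains \<sigma> where "\<And>q. q \<in> Q \<Longrightarrow> \<sigma> q \<in> S"
    and "(\<Sum>q\<in>Q. kcost d X (insert q (S - {\<sigma> q})))
           \<le> real (card Q) * kcost d X S - (kcost d X S - (\<Sum>x\<in>X. d x (a x)))
              + 4 * (\<Sum>x\<in>{x\<in>X. s x \<noteq> b x}. d x (b x))"
proof -
  have fin: "finite S" "finite Q" using S Q finite_centers by auto
  have sX: "s x \<in> S" "s x \<in> X" if "x \<in> X" for x using S that by (auto simp: nearest_map_def)
  have sb: "(\<lambda>q. s (b q)) ` Q \<subseteq> S" using Q b sX by auto
  obtain \<sigma> where \<sigma>: "\<And>q. q \<in> Q \<Longrightarrow> \<sigma> q \<in> S"
      "\<And>q r. \<lbrakk>q \<in> Q; r \<in> Q; r \<noteq> q\<rbrakk> \<Longrightarrow> s (b r) \<noteq> \<sigma> q"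
      "\<And>z. card {q \<in> Q. \<sigma> q = z} \<le> 2"
    by (rule swap_pairing[OF fin(2) fin(1) S(2)[symmetric] sb]) blast
  \<comment> \<open>The test swaps that take the center of \<open>x\<close> away without bringing in
    \<open>a x\<close>; the pairing allows at most two.\<close>
  define lost where "lost x = {q \<in> Q. q \<noteq> a x \<and> \<sigma> q = s x}" for x
  have lost_le: "card (lost x) \<le> 2" for x
    using fin \<sigma>(3)[of "s x"] by (elim order_trans[rotated]) (auto simp: lost_def intro!: card_mono)
  have detour: "d x (s (b x)) \<le> d x (s x) + 2 * d x (b x)" if x: "x \<in> X" for x
  proof -
    have "d x (s (b x)) \<le> d x (b x) + d (b x) (s (b x))"
      using x b sX by (intro triangle) auto
    moreover have "d (b x) (s (b x)) \<le> d (b x) (s x)"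
      using x b sX nearest_map_le[OF S(3) fin(1)] by auto
    moreover have "d (b x) (s x) \<le> d (b x) x + d x (s x)"
      using x b sX by (intro triangle) auto
    ultimately show ?thesis by (simp add: commute)
  qed
  \<comment> \<open>An upper bound for the cost of \<open>x\<close> after the swap of
    \<open>q\<close>: the old cost, corrected when \<open>x\<close> moves to \<open>q\<close> and
    surcharged when \<open>x\<close> takes the detour.\<close>
  define h where "h q x = d x (s x) + (if a x = q then d x (a x) - d x (s x) else 0)
      + (if q \<in> lost x then 2 * d x (b x) else 0)" for q x
  have swap: "kcost d X (insert q (S - {\<sigma> q})) \<le> (\<Sum>x\<in>X. h q x)" if q: "q \<in> Q" for q
    unfolding kcost_def
  proof (rule sum_mono)
    fix x assume x: "x \<in> X"
    let ?T = "insert q (S - {\<sigma> q})"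
    consider "a x = q" | "a x \<noteq> q" "\<sigma> q \<noteq> s x" | "a x \<noteq> q" "\<sigma> q = s x" by blast
    then show "dist_to d ?T x \<le> h q x"
    proof cases
      case 1
      then show ?thesis using dist_to_le[of ?T q d x] fin by (simp add: h_def lost_def)
    next
      case 2
      then show ?thesis using dist_to_le[of ?T "s x" d x] fin sX[OF x] by (simp add: h_def lost_def)
    next
      case 3
      \<comment> \<open>The detour target survives the swap: it equals \<open>s (b (a x))\<close>,
        and the pairing lets only the swap of \<open>a x\<close> remove that center.\<close>
      have "s (b (a x)) \<noteq> \<sigma> q" using 3 q x Q by (intro \<sigma>) auto
      then have "s (b x) \<in> ?T" using x b sX by auto
      then have "dist_to d ?T x \<le> d x (s (b x))" using fin by (intro dist_to_le) auto
      then show ?thesis using detour[OF x] 3 q by (simp add: h_def lost_def)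
    qed
  qed
  have point: "(\<Sum>q\<in>Q. h q x) \<le> real (card Q) * d x (s x) - d x (s x) + d x (a x)
      + (if s x \<noteq> b x then 4 * d x (b x) else 0)" if x: "x \<in> X" for x
  proof -
    have "(\<Sum>q\<in>Q. h q x) = real (card Q) * d x (s x) + (d x (a x) - d x (s x))
        + (\<Sum>q\<in>Q. if q \<in> lost x then 2 * d x (b x) else 0)"
      using fin Q(2)[OF x] by (simp add: h_def sum.distrib)
    also have "(\<Sum>q\<in>Q. if q \<in> lost x then 2 * d x (b x) else 0) = real (card (lost x)) * (2 * d x (b x))"
      using fin by (simp add: lost_def flip: sum.inter_filter)
    also have "real (card (lost x)) * (2 * d x (b x)) \<le> (if s x \<noteq> b x then 4 * d x (b x) else 0)"
    proof (cases "s x = b x")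
      case True
      \<comment> \<open>If \<open>S\<close> already serves \<open>x\<close> from \<open>b x\<close>,
        then \<open>s x\<close> is the detour target itself, so no swap other than that of
        \<open>a x\<close> drops it. Hence only points with \<open>s x\<close> \<noteq>
        \<open>b x\<close> pay a surcharge.\<close>
      have "s (b x) = s x" using nearest_map_fix[OF S(3) S(1) sX(1)[OF x]] True by simp
      then have "lost x = {}" using \<sigma>(2)[OF _ Q(2)[OF x]] x b by (force simp: lost_def)
      then show ?thesis using True by simp
    next
      case False
      have "real (card (lost x)) * (2 * d x (b x)) \<le> 2 * (2 * d x (b x))"
        using lost_le[of x] by (intro mult_right_mono) auto
      then show ?thesis using False by simp
    qed
    finally show ?thesis by simp
  qed
  have "(\<Sum>q\<in>Q. kcost d X (insert q (S - {\<sigma> q}))) \<le> (\<Sum>q\<in>Q. \<Sum>x\<in>X. h q x)"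
    by (intro sum_mono swap)
  also have "\<dots> = (\<Sum>x\<in>X. \<Sum>q\<in>Q. h q x)" by (rule sum.swap)
  also have "\<dots> \<le> (\<Sum>x\<in>X. real (card Q) * d x (s x) - d x (s x) + d x (a x)
      + (if s x \<noteq> b x then 4 * d x (b x) else 0))" by (intro sum_mono point)
  also have "\<dots> = real (card Q) * kcost d X S - (kcost d X S - (\<Sum>x\<in>X. d x (a x)))
              + 4 * (\<Sum>x\<in>{x\<in>X. s x \<noteq> b x}. d x (b x))"
    using finite_X
    by (simp add: kcost_nearest_map[OF S(3)] sum.distrib sum_subtractf flip: sum_distrib_left)
       (simp add: sum_distrib_left sum.inter_filter if_distrib cong: if_cong)
  finally show thesis using that \<sigma>(1) by blast
qed

section \<open>Stability and the gain of a best swap\<close>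

text \<open>Stability is applied to the perturbation that keeps the distance of each point to its
  current center and multiplies all others by \<open>\<alpha>\<close>: it leaves the cost of \<open>S\<close> unchanged.
  The optimal centers \<open>R\<close> of the perturbed instance need not be \<open>Q\<close>, only the clusters are.\<close>
lemma stable_reference:
  assumes "stable \<alpha> d X k" "1 \<le> \<alpha>"
    and Q: "opt_centers d X k Q" "nearest_map d X Q a"
    and S: "S \<subseteq> X" "card S = k" "nearest_map d X S s"
  obtains R b where "R \<subseteq> X" "card R = k" "\<And>x. x \<in> X \<Longrightarrow> b x \<in> R" "\<And>r. r \<in> R \<Longrightarrow> b r = r"
    and "\<And>x y. \<lbrakk>x \<in> X; y \<in> X\<rbrakk> \<Longrightarrow> a x = a y \<longleftrightarrow> b x = b y"
    and "kcost d X Q + (\<alpha> - 1) * (\<Sum>x\<in>{x\<in>X. s x \<noteq> b x}. d x (b x)) \<le> kcost d X S"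
proof -
  \<comment> \<open>In general \<open>e\<close> is not symmetric; its first argument is the point
    served, its second the center.\<close>
  define e where "e x y = (if y = s x then d x y else \<alpha> * d x y)" for x y
  have e: "d x y \<le> e x y" "e x y \<le> \<alpha> * d x y" for x y
    using assms(2) mult_right_mono[OF assms(2) nonneg[of x y]] by (auto simp: e_def)
  define P where "P = (\<lambda>c. {x\<in>X. a x = c}) ` Q"
  have "P \<in> optimal_clusterings d X k"
    unfolding optimal_clusterings_def induced_clusterings_def P_def
    using Q by (auto simp: nearest_map_def)
  then have "P \<in> optimal_clusterings e X k"
    using assms(1) e unfolding stable_def by blast
  then obtain R b where R: "opt_centers e X k R" and b: "nearest_map e X R b"
      and P: "P = (\<lambda>c. {x\<in>X. b x = c}) ` R"
    unfolding optimal_clusterings_def induced_clusterings_def nearest_map_def by blast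
  have RX: "R \<subseteq> X" "card R = k" and QX: "Q \<subseteq> X" "card Q = k"
    using R Q by (auto simp: opt_centers_def)
  have finR: "finite R" and finS: "finite S" using RX S finite_centers by auto
  have bR: "b x \<in> R" if "x \<in> X" for x using b that by (auto simp: nearest_map_def)
  show thesis
  proof
    show "R \<subseteq> X" "card R = k" by fact+
    show "b x \<in> R" if "x \<in> X" for x using bR that .
    \<comment> \<open>The perturbation keeps zero distances at zero, so a center of \<open>R\<close>
      is still at distance 0 from itself.\<close>
    show "b r = r" if r: "r \<in> R" for r
    proof -
      have rX: "r \<in> X" "b r \<in> X" using r RX bR by auto
      have "d r (b r) \<le> e r (b r)" by (rule e)
      also have "\<dots> \<le> e r r" using nearest_map_le[OF b finR rX(1) r] .
      also have "\<dots> \<le> \<alpha> * d r r" by (rule e)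
      finally have "d r (b r) \<le> 0" using rX by simp
      then show ?thesis using rX nonneg[of r "b r"] by (metis order_antisym zero)
    qed
    show "a x = a y \<longleftrightarrow> b x = b y" if xy: "x \<in> X" "y \<in> X" for x y
    proof -
      have "{z\<in>X. a z = a x} \<in> P" using xy Q by (auto simp: P_def nearest_map_def)
      then obtain c where c: "{z\<in>X. a z = a x} = {z\<in>X. b z = c}" unfolding P by auto
      then have "b x = c" using xy by blast
      have "a x = a y \<longleftrightarrow> y \<in> {z\<in>X. a z = a x}" using xy by auto
      also have "\<dots> \<longleftrightarrow> b x = b y" unfolding c using xy \<open>b x = c\<close> by auto
      finally show ?thesis .
    qed
    \<comment> \<open>Two optimality facts are chained: \<open>Q\<close> beats \<open>R\<close>
      under \<open>d\<close>, and \<open>R\<close> beats \<open>S\<close> under \<open>e\<close>. In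
      between, \<alpha> - 1 is exactly the surcharge of \<open>e\<close> over \<open>d\<close> at a
      point with \<open>s x\<close> \<noteq> \<open>b x\<close>.\<close>
    have "kcost d X Q + (\<alpha> - 1) * (\<Sum>x\<in>{x\<in>X. s x \<noteq> b x}. d x (b x))
        \<le> kcost d X R + (\<alpha> - 1) * (\<Sum>x\<in>{x\<in>X. s x \<noteq> b x}. d x (b x))"
      using Q RX by (auto simp: opt_centers_def)
    also have "\<dots> \<le> (\<Sum>x\<in>X. d x (b x)) + (\<alpha> - 1) * (\<Sum>x\<in>{x\<in>X. s x \<noteq> b x}. d x (b x))"
      using kcost_le[OF finR bR] by simp
    also have "\<dots> = (\<Sum>x\<in>X. d x (b x) + (if s x \<noteq> b x then (\<alpha> - 1) * d x (b x) else 0))"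
      unfolding sum_distrib_left sum.inter_filter[OF finite_X] sum.distrib[symmetric]
      by (intro sum.cong) auto
    also have "\<dots> = (\<Sum>x\<in>X. e x (b x))"
      by (intro sum.cong) (auto simp: e_def algebra_simps)
    also have "\<dots> = kcost e X R" using kcost_nearest_map[OF b] by simp
    also have "\<dots> \<le> kcost e X S" using R S by (auto simp: opt_centers_def)
    also have "\<dots> \<le> (\<Sum>x\<in>X. e x (s x))"
      using S finS by (intro kcost_le) (auto simp: nearest_map_def)
    also have "\<dots> = kcost d X S" using kcost_nearest_map[OF S(3)] by (simp add: e_def)
    finally show "kcost d X Q + (\<alpha> - 1) * (\<Sum>x\<in>{x\<in>X. s x \<noteq> b x}. d x (b x)) \<le> kcost d X S" .
  qed
qed

text \<open>Stability bounds the detour sum by \<open>gap / (\<alpha> - 1)\<close>, so the four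
  copies of it use up only the fraction \<open>4 / (\<alpha> - 1)\<close> of the gap.\<close>

lemma sum_test_swaps_stable:
  assumes st: "stable \<alpha> d X k" "1 < \<alpha>" and Q: "opt_centers d X k Q"
    and S: "S \<subseteq> X" "card S = k" "1 \<le> k"
  obtains \<sigma> where "\<And>q. q \<in> Q \<Longrightarrow> \<sigma> q \<in> S"
    and "(\<Sum>q\<in>Q. kcost d X (insert q (S - {\<sigma> q})))
           \<le> real k * kcost d X S - (\<alpha> - 5) / (\<alpha> - 1) * (kcost d X S - kcost d X Q)"
proof -
  have QX: "Q \<subseteq> X" "card Q = k" using Q by (auto simp: opt_centers_def)
  have "finite Q" "Q \<noteq> {}" "finite S" "S \<noteq> {}" using QX S finite_centers by auto
  then obtain a s where a: "nearest_map d X Q a" and s: "nearest_map d X S s"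
    using nearest_map_exists by metis
  obtain R b where R: "R \<subseteq> X" "\<And>x. x \<in> X \<Longrightarrow> b x \<in> R"
    and ab: "\<And>x y. \<lbrakk>x \<in> X; y \<in> X\<rbrakk> \<Longrightarrow> a x = a y \<longleftrightarrow> b x = b y"
    and W: "kcost d X Q + (\<alpha> - 1) * (\<Sum>x\<in>{x\<in>X. s x \<noteq> b x}. d x (b x)) \<le> kcost d X S"
    by (rule stable_reference[OF st(1) less_imp_le[OF st(2)] Q a S(1,2) s]) blast
  have aQ: "a x \<in> Q" if "x \<in> X" for x using a that by (auto simp: nearest_map_def)
  have baX: "b (a x) = b x" if "x \<in> X" for x
    using ab[of "a x" x] nearest_map_fix[OF a QX(1) aQ[OF that]] aQ[OF that] QX that by auto
  let ?W = "\<Sum>x\<in>{x\<in>X. s x \<noteq> b x}. d x (b x)"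
  have cS: "card S = card Q" using S(2) QX(2) by simp
  have bX: "b x \<in> X" if "x \<in> X" for x
    using R that by auto
  obtain \<sigma> where \<sigma>: "\<And>q. q \<in> Q \<Longrightarrow> \<sigma> q \<in> S"
    and sum: "(\<Sum>q\<in>Q. kcost d X (insert q (S - {\<sigma> q})))
           \<le> real (card Q) * kcost d X S - (kcost d X S - (\<Sum>x\<in>X. d x (a x))) + 4 * ?W"
    by (rule sum_test_swaps[where a = a and b = b, OF S(1) cS s QX(1) aQ bX baX]) (assumption | rule that)+
  define g where "g = kcost d X S - kcost d X Q"
  define w where "w = ?W"
  have "w \<le> g / (\<alpha> - 1)"
    using W st(2) by (simp add: pos_le_divide_eq mult.commute g_def w_def)
  moreover have "(\<alpha> - 5) / (\<alpha> - 1) = 1 - 4 / (\<alpha> - 1)" using st(2) by (simp add: diff_divide_eq_iff)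
  then have "(\<alpha> - 5) / (\<alpha> - 1) * g = g - 4 * (g / (\<alpha> - 1))"
    by (simp add: left_diff_distrib)
  ultimately have "real k * kcost d X S - g + 4 * w
      \<le> real k * kcost d X S - (\<alpha> - 5) / (\<alpha> - 1) * g"
    by linarith
  moreover have "(\<Sum>q\<in>Q. kcost d X (insert q (S - {\<sigma> q}))) \<le> real k * kcost d X S - g + 4 * w"
    using sum QX(2) by (simp only: kcost_nearest_map[OF a, symmetric] g_def w_def)
  ultimately have "(\<Sum>q\<in>Q. kcost d X (insert q (S - {\<sigma> q})))
      \<le> real k * kcost d X S - (\<alpha> - 5) / (\<alpha> - 1) * (kcost d X S - kcost d X Q)"
    unfolding g_def by linarith
  then show thesis using \<sigma> by (rule that[rotated])
qed

text \<open>At a local optimum no test swap costs less than \<open>S\<close>, so the averaged bound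
  leaves a positive multiple of the gap that is at most 0.\<close>

lemma stable_swap_stops_opt:
  assumes st: "stable \<alpha> d X k" "5 < \<alpha>"
    and S: "S \<subseteq> X" "card S = k" "1 \<le> k" and stop: "swap_stops d X S"
  shows "opt_centers d X k S"
proof -
  have "k \<le> card X" using S finite_X card_mono by blast
  then obtain Q where Q: "opt_centers d X k Q" by (rule opt_centers_exists)
  then have QX: "Q \<subseteq> X" "card Q = k" by (auto simp: opt_centers_def)
  obtain \<sigma> where \<sigma>: "\<And>q. q \<in> Q \<Longrightarrow> \<sigma> q \<in> S"
    and sum: "(\<Sum>q\<in>Q. kcost d X (insert q (S - {\<sigma> q})))
           \<le> real k * kcost d X S - (\<alpha> - 5) / (\<alpha> - 1) * (kcost d X S - kcost d X Q)"
    using sum_test_swaps_stable[OF st(1) _ Q S] st(2) by auto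
  have "real k * kcost d X S = (\<Sum>q\<in>Q. kcost d X S)" using QX by simp
  also have "\<dots> \<le> (\<Sum>q\<in>Q. kcost d X (insert q (S - {\<sigma> q})))"
    using stop QX \<sigma> unfolding swap_stops_def by (intro sum_mono) blast
  finally have "(\<alpha> - 5) / (\<alpha> - 1) * (kcost d X S - kcost d X Q) \<le> 0" using sum by simp
  then have "kcost d X S \<le> kcost d X Q"
    using st(2) by (auto simp: mult_le_0_iff divide_le_0_iff)
  then show ?thesis using Q S unfolding opt_centers_def by (meson order_trans)
qed

text \<open>The chosen swap is at least as good as each of the \<open>k\<close> test swaps, hence as
  good as their average.\<close>

lemma swap_step_gap:
  assumes st: "stable \<alpha> d X k" "1 < \<alpha>" and Q: "opt_centers d X k Q"
    and S: "S \<subseteq> X" "card S = k" "1 \<le> k" and step: "swap_step d X S S'"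
  shows "kcost d X S' - kcost d X Q
           \<le> (1 - (\<alpha> - 5) / (\<alpha> - 1) / real k) * (kcost d X S - kcost d X Q)"
proof -
  have QX: "Q \<subseteq> X" "card Q = k" using Q by (auto simp: opt_centers_def)
  obtain \<sigma> where \<sigma>: "\<And>q. q \<in> Q \<Longrightarrow> \<sigma> q \<in> S"
    and sum: "(\<Sum>q\<in>Q. kcost d X (insert q (S - {\<sigma> q})))
           \<le> real k * kcost d X S - (\<alpha> - 5) / (\<alpha> - 1) * (kcost d X S - kcost d X Q)"
    using sum_test_swaps_stable[OF st Q S] by auto
  have "real k * kcost d X S' = (\<Sum>q\<in>Q. kcost d X S')" using QX by simp
  also have "\<dots> \<le> (\<Sum>q\<in>Q. kcost d X (insert q (S - {\<sigma> q})))"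
    using step QX \<sigma> unfolding swap_step_def by (intro sum_mono) blast
  finally have *: "real k * kcost d X S'
      \<le> real k * kcost d X S - (\<alpha> - 5) / (\<alpha> - 1) * (kcost d X S - kcost d X Q)"
    using sum by linarith
  define e g where "e = (\<alpha> - 5) / (\<alpha> - 1)" and "g = kcost d X S - kcost d X Q"
  have "e * g \<le> (kcost d X S - kcost d X S') * real k"
    using * by (simp add: e_def g_def algebra_simps)
  then have "e * g / real k \<le> kcost d X S - kcost d X S'"
    using S(3) by (simp add: pos_divide_le_eq)
  moreover have "(1 - e / real k) * g = g - e * g / real k"
    by (simp add: left_diff_distrib)
  ultimately show ?thesis unfolding e_def[symmetric] g_def by linarith
qed

text \<open>Inserting a point that is already a center could only remove centers, which never lowers
  the cost. So an improving swap brings in a new point and keeps the number of centers.\<close>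

lemma swap_step_centers:
  assumes "swap_step d X S S'" "S \<subseteq> X"
  shows "S' \<subseteq> X" "card S' = card S"
    and "\<exists>x\<in>X - S. \<exists>y\<in>S. S' = insert x (S - {y})"
proof -
  obtain x y where xy: "x \<in> X" "y \<in> S" "S' = insert x (S - {y})"
    and less: "kcost d X S' < kcost d X S"
    using assms(1) by (auto simp: swap_step_def)
  have fin: "finite S" using assms(2) by (rule finite_centers)
  have "x \<notin> S"
  proof
    assume "x \<in> S"
    then have "S' \<subseteq> S" "S' \<noteq> {}" using xy by auto
    then have "kcost d X S \<le> kcost d X S'" by (intro kcost_mono fin)
    then show False using less by simp
  qed
  then show "\<exists>x\<in>X - S. \<exists>y\<in>S. S' = insert x (S - {y})" using xy by blast
  show "S' \<subseteq> X" using xy assms by auto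
  show "card S' = card S" using xy \<open>x \<notin> S\<close> fin card_Suc_Diff1[OF fin xy(2)] by simp
qed

section \<open>The last phase: settling the center of each cluster\<close>

text \<open>Here \<open>q\<close> is any candidate center for its own cluster; it need not be
  \<open>a q\<close>.\<close>

definition cluster_cost :: "('a \<Rightarrow> 'a) \<Rightarrow> 'a \<Rightarrow> real" where
  "cluster_cost a q = (\<Sum>x\<in>{x\<in>X. a x = a q}. d x q)"

lemma sum_clusters:
  assumes "bij_betw a T Q" "finite Q" "\<And>x. x \<in> X \<Longrightarrow> a x \<in> Q"
  shows "(\<Sum>q\<in>T. \<Sum>x\<in>{x\<in>X. a x = a q}. g x) = (\<Sum>x\<in>X. g x :: real)"
proof -
  have "(\<Sum>q\<in>T. \<Sum>x\<in>{x\<in>X. a x = a q}. g x) = (\<Sum>c\<in>Q. \<Sum>x\<in>{x\<in>X. a x = c}. g x)"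
    by (rule sum.reindex_bij_betw[OF assms(1)])
  also have "\<dots> = (\<Sum>x\<in>X. g x)"
    using assms finite_X by (intro sum.group) auto
  finally show ?thesis .
qed

text \<open>\<open>T\<close> has one member in each cluster. Serving every cluster from its member
  is a legal assignment, though perhaps not to nearest centers.\<close>

lemma kcost_le_cluster_costs:
  assumes "T \<subseteq> X" "bij_betw a T Q" "finite Q" "\<And>x. x \<in> X \<Longrightarrow> a x \<in> Q"
  shows "kcost d X T \<le> (\<Sum>q\<in>T. cluster_cost a q)"
proof -
  have "kcost d X T = (\<Sum>q\<in>T. \<Sum>x\<in>{x\<in>X. a x = a q}. dist_to d T x)"
    unfolding kcost_def using sum_clusters[OF assms(2-4)] by simp
  also have "\<dots> \<le> (\<Sum>q\<in>T. cluster_cost a q)"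
    unfolding cluster_cost_def using finite_centers[OF assms(1)] by (intro sum_mono dist_to_le) auto
  finally show ?thesis .
qed

text \<open>Equality of partitions, stated as equality of the kernels of the two maps;
  \<open>s\<close> is existential because of ties.\<close>

definition induces :: "'a set \<Rightarrow> ('a \<Rightarrow> 'a) \<Rightarrow> bool" where
  "induces S a \<longleftrightarrow> (\<exists>s. nearest_map d X S s \<and> (\<forall>x\<in>X. \<forall>y\<in>X. a x = a y \<longleftrightarrow> s x = s y))"

lemma induces_bij_betw:
  assumes "induces S a" "S \<subseteq> X" "card S = card Q" "finite Q" "\<And>x. x \<in> X \<Longrightarrow> a x \<in> Q"
  shows "bij_betw a S Q"
proof -
  obtain s where s: "nearest_map d X S s" "\<forall>x\<in>X. \<forall>y\<in>X. a x = a y \<longleftrightarrow> s x = s y"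
    using assms(1) by (auto simp: induces_def)
  have "inj_on a S"
  proof (rule inj_onI)
    fix q r assume qr: "q \<in> S" "r \<in> S" "a q = a r"
    then have "s q = s r" using s(2) assms(2) by blast
    then show "q = r" using nearest_map_fix[OF s(1) assms(2)] qr by simp
  qed
  moreover from this have "a ` S = Q"
    using assms by (intro card_subset_eq) (auto simp: card_image)
  ultimately show ?thesis by (simp add: bij_betw_def)
qed

text \<open>Here the member of \<open>S\<close> in a cluster is a nearest center for the whole
  cluster, so the upper bound by cluster costs is attained.\<close>

lemma kcost_induces:
  assumes "induces S a" "S \<subseteq> X" "card S = card Q" "finite Q" "\<And>x. x \<in> X \<Longrightarrow> a x \<in> Q"
  shows "kcost d X S = (\<Sum>q\<in>S. cluster_cost a q)"
proof -
  obtain s where s: "nearest_map d X S s" "\<And>x y. \<lbrakk>x \<in> X; y \<in> X\<rbrakk> \<Longrightarrow> a x = a y \<longleftrightarrow> s x = s y"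
    using assms(1) by (auto simp: induces_def)
  have "dist_to d S x = d x q" if "q \<in> S" "x \<in> X" "a x = a q" for q x
  proof -
    have "s x = q"
      using that s(2)[of x q] nearest_map_fix[OF s(1) assms(2) that(1)] assms(2) by auto
    then show ?thesis using s(1) that(2) by (auto simp: nearest_map_def)
  qed
  then have "(\<Sum>q\<in>S. cluster_cost a q) = (\<Sum>q\<in>S. \<Sum>x\<in>{x\<in>X. a x = a q}. dist_to d S x)"
    unfolding cluster_cost_def by (intro sum.cong refl) auto
  also have "\<dots> = kcost d X S"
    unfolding kcost_def by (rule sum_clusters[OF induces_bij_betw[OF assms] assms(4,5)])
  finally show ?thesis by simp
qed

text \<open>Its cardinality is the potential that bounds the length of the last phase.\<close>

definition improvable :: "('a \<Rightarrow> 'a) \<Rightarrow> 'a set \<Rightarrow> 'a set" where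
  "improvable a S = {q\<in>S. \<exists>z\<in>X. a z = a q \<and> cluster_cost a z < cluster_cost a q}"

text \<open>Once the clusters are right, a swap replaces the center of one cluster, and the best such
  swap makes it a best center of that cluster.\<close>
lemma card_improvable_decreases:
  assumes Q: "finite Q" "\<And>x. x \<in> X \<Longrightarrow> a x \<in> Q"
    and S: "induces S a" "S \<subseteq> X" "card S = card Q"
    and S': "induces S' a" and step: "swap_step d X S S'"
  shows "card (improvable a S') < card (improvable a S)"
proof -
  obtain x y where xy: "x \<in> X" "x \<notin> S" "y \<in> S" "S' = insert x (S - {y})"
    using swap_step_centers(3)[OF step S(2)] by blast
  have S'X: "S' \<subseteq> X" "card S' = card Q"
    using swap_step_centers[OF step S(2)] S(3) by auto
  have bij: "bij_betw a S Q" "bij_betw a S' Q"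
    using induces_bij_betw[OF S Q] induces_bij_betw[OF S' S'X Q] by auto
  have fin: "finite S" "finite S'" using S(2) S'X finite_centers by auto
  have yX: "y \<in> X" using xy S by auto
  \<comment> \<open>The member \<open>q\<close> of \<open>S\<close> in the cluster of
    \<open>x\<close> cannot stay beside \<open>x\<close> in \<open>S'\<close>, so it is the center
    removed.\<close>
  have axy: "a x = a y"
  proof -
    obtain q where q: "q \<in> S" "a q = a x"
      using bij(1) Q(2)[OF xy(1)] by (metis bij_betw_imp_surj_on imageE)
    have "q \<notin> S'" using q xy bij(2) unfolding bij_betw_def inj_on_def by blast
    then show ?thesis using q xy by auto
  qed
  let ?rest = "\<Sum>q\<in>S - {y}. cluster_cost a q"
  have cost: "kcost d X S = cluster_cost a y + ?rest" "kcost d X S' = cluster_cost a x + ?rest"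
    using kcost_induces[OF S Q] kcost_induces[OF S' S'X Q] fin xy by (auto simp: sum.remove)
  \<comment> \<open>Replacing \<open>y\<close> by \<open>z\<close> was a competing swap, and it too
    leaves one center in each cluster.\<close>
  have best: "cluster_cost a x \<le> cluster_cost a z" if z: "z \<in> X" "a z = a x" for z
  proof -
    let ?T = "insert z (S - {y})"
    have zS: "z \<notin> S - {y}"
      using z axy xy bij(1) unfolding bij_betw_def inj_on_def by auto
    have "a ` ?T = a ` S" using z axy xy by auto
    moreover have "inj_on a ?T"
      using z axy xy bij(1) unfolding bij_betw_def inj_on_def by auto
    ultimately have "bij_betw a ?T Q" using bij(1) by (simp add: bij_betw_def)
    then have "kcost d X ?T \<le> (\<Sum>q\<in>?T. cluster_cost a q)"
      using z S Q by (intro kcost_le_cluster_costs) auto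
    moreover have "kcost d X S' \<le> kcost d X ?T"
      using step z xy unfolding swap_step_def by blast
    ultimately show ?thesis using cost fin zS by simp
  qed
  have "kcost d X S' < kcost d X S" using step by (simp add: swap_step_def)
  then have less: "cluster_cost a x < cluster_cost a y" using cost by simp
  have "improvable a S' \<subseteq> improvable a S - {y}"
    using best xy by (force simp: improvable_def)
  moreover have "y \<in> improvable a S" using less xy axy by (auto simp: improvable_def)
  moreover have "finite (improvable a S)" using fin by (simp add: improvable_def)
  ultimately show ?thesis
    by (metis card_Diff1_less card_mono finite_Diff le_less_trans)
qed

text \<open>The detour sum is below \<mu>, so each of its terms is 0: a point on which
  \<open>s\<close> and \<open>b\<close> disagree is its own center in \<open>R\<close>. This forces
  first \<open>S = R\<close>, then \<open>s = b\<close> on \<open>X\<close>.\<close>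

lemma small_gap_induces:
  assumes st: "stable \<alpha> d X k" "1 < \<alpha>"
    and Q: "opt_centers d X k Q" "nearest_map d X Q a"
    and S: "S \<subseteq> X" "card S = k" "1 \<le> k"
    and sep: "\<And>x y. \<lbrakk>x \<in> X; y \<in> X; x \<noteq> y\<rbrakk> \<Longrightarrow> \<mu> \<le> d x y"
    and gap: "kcost d X S - kcost d X Q < (\<alpha> - 1) * \<mu>"
  shows "induces S a"
proof -
  have "finite S" "S \<noteq> {}" using S finite_centers by auto
  then obtain s where s: "nearest_map d X S s" using nearest_map_exists by metis
  obtain R b where R: "R \<subseteq> X" "card R = k" "\<And>x. x \<in> X \<Longrightarrow> b x \<in> R" "\<And>r. r \<in> R \<Longrightarrow> b r = r"
    and ab: "\<And>x y. \<lbrakk>x \<in> X; y \<in> X\<rbrakk> \<Longrightarrow> a x = a y \<longleftrightarrow> b x = b y"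
    and W: "kcost d X Q + (\<alpha> - 1) * (\<Sum>x\<in>{x\<in>X. s x \<noteq> b x}. d x (b x)) \<le> kcost d X S"
    by (rule stable_reference[OF st(1) less_imp_le[OF st(2)] Q S(1,2) s]) blast
  have moved: "b x = x" if x: "x \<in> X" "s x \<noteq> b x" for x
  proof (rule ccontr)
    assume "b x \<noteq> x"
    then have "\<mu> \<le> d x (b x)" using x R by (intro sep) auto
    also have "\<dots> \<le> (\<Sum>x\<in>{x\<in>X. s x \<noteq> b x}. d x (b x))"
      using x finite_X by (intro member_le_sum) auto
    finally have "(\<alpha> - 1) * \<mu> \<le> (\<alpha> - 1) * (\<Sum>x\<in>{x\<in>X. s x \<noteq> b x}. d x (b x))"
      using st(2) by (intro mult_left_mono) auto
    then show False using W gap by simp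
  qed
  have sS: "s q = q" if "q \<in> S" for q using nearest_map_fix[OF s S(1) that] .
  have "S \<subseteq> R"
  proof
    fix q assume q: "q \<in> S"
    then have "q \<in> X" "s q = q" using sS S(1) by auto
    then have "b q = q" using moved[of q] by (cases "b q = q") auto
    then show "q \<in> R" using R(3)[of q] q S(1) by auto
  qed
  then have "S = R" using S R finite_centers by (metis card_subset_eq)
  have "s x = b x" if x: "x \<in> X" for x
  proof (rule ccontr)
    assume neq: "s x \<noteq> b x"
    then have "x \<in> R" using moved[OF x] R(3)[OF x] by auto
    then show False using neq moved[OF x] sS \<open>S = R\<close> by auto
  qed
  then show ?thesis using s ab by (auto simp: induces_def)
qed

section \<open>Counting iterations\<close>

lemma kcost_bound:
  assumes "S \<subseteq> X" "S \<noteq> {}" and diam: "\<And>x y. \<lbrakk>x \<in> X; y \<in> X\<rbrakk> \<Longrightarrow> d x y \<le> \<nu>"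
  shows "kcost d X S \<le> real (card X) * \<nu>"
proof -
  obtain s where s: "nearest_map d X S s"
    using nearest_map_exists assms finite_centers by metis
  have "kcost d X S = (\<Sum>x\<in>X. d x (s x))" using kcost_nearest_map[OF s] .
  also have "\<dots> \<le> (\<Sum>x\<in>X. \<nu>)"
    using s assms(1) by (intro sum_mono diam) (auto simp: nearest_map_def)
  finally show ?thesis by simp
qed

lemma kcost_nonneg:
  assumes "S \<subseteq> X" "S \<noteq> {}"
  shows "0 \<le> kcost d X S"
proof -
  obtain s where s: "nearest_map d X S s"
    using nearest_map_exists assms finite_centers by metis
  show ?thesis unfolding kcost_nearest_map[OF s] by (simp add: sum_nonneg)
qed

text \<open>While the gap is at least \<open>(\<alpha> - 1) * \<mu>\<close>, geometric decay limits
  the number of steps; below this threshold the clusters are right and at most \<open>k\<close>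
  steps remain.\<close>

lemma swap_iterations:
  assumes st: "stable \<alpha> d X k" "5 < \<alpha>" and k: "1 \<le> k"
    and run: "run 0 \<subseteq> X" "card (run 0) = k" "\<And>i. i < m \<Longrightarrow> swap_step d X (run i) (run (Suc i))"
    and sep: "0 < \<mu>" "\<And>x y. \<lbrakk>x \<in> X; y \<in> X; x \<noteq> y\<rbrakk> \<Longrightarrow> \<mu> \<le> d x y"
    and diam: "\<And>x y. \<lbrakk>x \<in> X; y \<in> X\<rbrakk> \<Longrightarrow> d x y \<le> \<nu>"
    and L: "L = ln (real (card X) * (\<nu> / \<mu>))" "0 \<le> L"
  shows "run m \<subseteq> X \<and> card (run m) = k \<and> real m \<le> (\<alpha> - 1) / (\<alpha> - 5) * real k * L + 1 + real k"
proof -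
  have centers: "run i \<subseteq> X \<and> card (run i) = k" if "i \<le> m" for i
    using that
  proof (induction i)
    case 0
    then show ?case using run by simp
  next
    case (Suc i)
    then show ?case using swap_step_centers[OF run(3)[of i]] by simp
  qed
  have ne: "run i \<noteq> {}" if "i \<le> m" for i using centers[OF that] k by auto
  have "k \<le> card X" using run finite_X card_mono by blast
  then obtain Q where Q: "opt_centers d X k Q" by (rule opt_centers_exists)
  then have QX: "Q \<subseteq> X" "card Q = k" by (auto simp: opt_centers_def)
  have finQ: "finite Q" "Q \<noteq> {}" using QX k finite_centers by auto
  then obtain a where a: "nearest_map d X Q a" using nearest_map_exists by metis
  have aQ: "a x \<in> Q" if "x \<in> X" for x using a that by (auto simp: nearest_map_def)
  define gap where "gap i = kcost d X (run i) - kcost d X Q" for i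
  have gap0: "0 \<le> gap i" if "i \<le> m" for i
    using Q centers[OF that] by (auto simp: gap_def opt_centers_def)
  define \<epsilon> where "\<epsilon> = (\<alpha> - 5) / (\<alpha> - 1)"
  have \<epsilon>: "0 < \<epsilon>" "\<epsilon> \<le> 1" using st(2) by (auto simp: \<epsilon>_def)
  have shrink: "gap (Suc i) \<le> (1 - \<epsilon> / real k) * gap i" if "i < m" for i
    using swap_step_gap[OF st(1) _ Q _ _ k run(3)[OF that]] centers[of i] st(2) that
    by (simp add: gap_def \<epsilon>_def)
  have factor: "0 \<le> 1 - \<epsilon> / real k" "1 - \<epsilon> / real k \<le> exp (- (\<epsilon> / real k))"
    using \<epsilon> k exp_ge_add_one_self[of "- (\<epsilon> / real k)"] by (auto simp: field_simps)
  have decay: "gap i \<le> exp (- (real i * (\<epsilon> / real k))) * gap 0" if "i \<le> m" for i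
    using that
  proof (induction i)
    case (Suc i)
    have "gap (Suc i) \<le> (1 - \<epsilon> / real k) * gap i" using Suc by (intro shrink) auto
    also have "\<dots> \<le> exp (- (\<epsilon> / real k)) * gap i"
      using Suc factor gap0 by (intro mult_right_mono) auto
    also have "\<dots> \<le> exp (- (\<epsilon> / real k)) * (exp (- (real i * (\<epsilon> / real k))) * gap 0)"
      using Suc by (intro mult_left_mono) auto
    also have "\<dots> = exp (- (real (Suc i) * (\<epsilon> / real k))) * gap 0"
      by (simp add: add_divide_distrib distrib_right mult_exp_exp mult.assoc[symmetric])
    finally show ?case .
  qed simp
  have early: "real i \<le> real k * L / \<epsilon>" if i: "i \<le> m" and big: "(\<alpha> - 1) * \<mu> \<le> gap i" for i
  proof -
    have "gap 0 \<le> kcost d X (run 0)" using kcost_nonneg[OF QX(1) finQ(2)] by (simp add: gap_def)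
    also have "\<dots> \<le> real (card X) * \<nu>" using run ne[of 0] by (intro kcost_bound diam) auto
    finally have start: "gap 0 \<le> real (card X) * \<nu>" .
    \<comment> \<open>The factor \<alpha> - 1 exceeds 1 and may be dropped, so the logarithm
      involves only the ratio of the distances.\<close>
    have "\<mu> \<le> (\<alpha> - 1) * \<mu>" using st(2) sep by simp
    also have "\<dots> \<le> exp (- (real i * (\<epsilon> / real k))) * gap 0"
      using big decay[OF i] by linarith
    also have "\<dots> \<le> exp (- (real i * (\<epsilon> / real k))) * (real (card X) * \<nu>)"
      using start by (intro mult_left_mono) auto
    finally have "exp (real i * (\<epsilon> / real k)) * \<mu>
        \<le> exp (real i * (\<epsilon> / real k)) * (exp (- (real i * (\<epsilon> / real k))) * (real (card X) * \<nu>))"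
      by (rule mult_left_mono) simp
    also have "\<dots> = real (card X) * \<nu>" by (simp only: mult.assoc[symmetric] exp_minus_inverse mult_1)
    finally have le: "exp (real i * (\<epsilon> / real k)) \<le> real (card X) * (\<nu> / \<mu>)"
      using sep(1) by (simp add: pos_le_divide_eq)
    then have "real i * (\<epsilon> / real k) \<le> L"
      unfolding L(1) using exp_gt_zero[of "real i * (\<epsilon> / real k)"]
      by (subst ln_ge_iff) linarith+
    then show ?thesis using \<epsilon> k by (simp add: field_simps)
  qed
  have mono: "gap (Suc i) \<le> gap i" if "i < m" for i
    using run(3)[OF that] by (simp add: gap_def swap_step_def)
  have late: "real m \<le> real j + real k" if j: "j \<le> m" and small: "gap j < (\<alpha> - 1) * \<mu>" for j
  proof -
    have small': "gap i < (\<alpha> - 1) * \<mu>" if "j \<le> i" "i \<le> m" for i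
      using that(1,2)
    proof (induction i rule: dec_induct)
      case base
      show ?case by (rule small)
    next
      case (step i)
      then show ?case using mono[of i] by simp
    qed
    have ind: "induces (run i) a" if "j \<le> i" "i \<le> m" for i
      using small_gap_induces[OF st(1) _ Q a _ _ k sep(2)] small'[OF that] centers[OF that(2)] st(2)
      by (simp add: gap_def)
    \<comment> \<open>The potential starts at no more than \<open>k\<close> and pays for every step
      taken since \<open>j\<close>.\<close>
    have "card (improvable a (run i)) + (i - j) \<le> k" if "j \<le> i" "i \<le> m" for i
      using that
    proof (induction i rule: dec_induct)
      case base
      have "improvable a (run j) \<subseteq> run j" by (auto simp: improvable_def)
      then have "card (improvable a (run j)) \<le> card (run j)"
        using centers[OF j] finite_centers by (intro card_mono) auto
      then show ?case using centers[OF j] by simp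
    next
      case (step i)
      have "card (improvable a (run (Suc i))) < card (improvable a (run i))"
        using step centers[of i] QX ind run(3)
        by (intro card_improvable_decreases[OF finQ(1) aQ]) auto
      then show ?case using step by simp
    qed
    from this[OF j order_refl] show ?thesis by linarith
  qed
  have conv: "(\<alpha> - 1) / (\<alpha> - 5) * real k * L = real k * L / \<epsilon>" by (simp add: \<epsilon>_def)
  have "real m \<le> real k * L / \<epsilon> + 1 + real k"
  proof (cases "\<exists>j\<le>m. gap j < (\<alpha> - 1) * \<mu>")
    case False
    then show ?thesis using early[of m] by force
  next
    case True
    \<comment> \<open>The first index below the threshold. Its predecessor, if any, is still above
      it, whence the additional 1.\<close>
    define j where "j = (LEAST j. gap j < (\<alpha> - 1) * \<mu>)"
    obtain i where i: "i \<le> m" "gap i < (\<alpha> - 1) * \<mu>" using True by blast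
    then have j: "gap j < (\<alpha> - 1) * \<mu>" "j \<le> m"
      unfolding j_def using LeastI[of "\<lambda>j. gap j < (\<alpha> - 1) * \<mu>" i]
        Least_le[of "\<lambda>j. gap j < (\<alpha> - 1) * \<mu>" i] by simp_all
    have "real j \<le> real k * L / \<epsilon> + 1"
    proof (cases j)
      case 0
      then show ?thesis using L(2) \<epsilon> by simp
    next
      case (Suc i)
      then have "\<not> gap i < (\<alpha> - 1) * \<mu>" using not_less_Least[of i "\<lambda>j. gap j < (\<alpha> - 1) * \<mu>"] by (simp add: j_def)
      then show ?thesis using early[of i] Suc j(2) by simp
    qed
    then show ?thesis using late[OF j(2,1)] by simp
  qed
  then show ?thesis using centers[of m] conv by simp
qed

end

section \<open>Points of the plane: from extreme distances to the spread\<close>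

text \<open>\<open>run\<close> may be any initial segment of an execution, so bounding
  \<open>m\<close> also gives termination. The extra 1 counts the iteration that finds no improving
  swap.\<close>

theorem mainTheorem8:
  fixes \<alpha> :: real and p :: ereal
  assumes "\<alpha> > 5" and "p \<ge> 1"
  shows "\<exists>C > 0. \<forall>(X :: pt set) k (run :: nat \<Rightarrow> pt set) m.
           finite X \<and> card X \<ge> 2 \<and> 1 \<le> k \<and> k \<le> card X \<and>
           stable \<alpha> (lp_dist p) X k \<and>
           run 0 \<subseteq> X \<and> card (run 0) = k \<and>
           (\<forall>i<m. swap_step (lp_dist p) X (run i) (run (Suc i)))
           \<longrightarrow> real m + 1 \<le> C * real k * ln (real (card X) * spread (lp_dist p) X) \<and>
               (swap_stops (lp_dist p) X (run m) \<longrightarrow>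
                  induced_clusterings (lp_dist p) X (run m) \<subseteq> optimal_clusterings (lp_dist p) X k)"
proof -
  define A where "A = (\<alpha> - 1) / (\<alpha> - 5)"
  \<comment> \<open>The term \<open>3 / ln 2\<close> absorbs the additive \<open>2 + k\<close> \<le>
    \<open>3 * k\<close>, because the logarithm is at least \<open>ln 2\<close>. The constant
    depends on \<alpha> alone.\<close>
  define C where "C = A + 3 / ln 2"
  have "0 < C" using assms(1) by (simp add: C_def A_def add_pos_pos)
  moreover have "real m + 1 \<le> C * real k * ln (real (card X) * spread (lp_dist p) X) \<and>
               (swap_stops (lp_dist p) X (run m) \<longrightarrow>
                  induced_clusterings (lp_dist p) X (run m) \<subseteq> optimal_clusterings (lp_dist p) X k)"
    if X: "finite X" "card X \<ge> 2" and k: "1 \<le> k" and st: "stable \<alpha> (lp_dist p) X k"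
      and run: "run 0 \<subseteq> X" "card (run 0) = k"
        "\<And>i. i < m \<Longrightarrow> swap_step (lp_dist p) X (run i) (run (Suc i))"
    for X k run m
  proof -
    have "Metric_space X (lp_dist p)"
      using Metric_space.subspace[OF Metric_space_lp_dist[OF assms(2)]] by simp
    then interpret finite_metric X "lp_dist p"
      using X(1) by (simp add: finite_metric_def finite_metric_axioms_def)
    define D where "D = {lp_dist p x y | x y. x \<in> X \<and> y \<in> X \<and> x \<noteq> y}"
    have "D \<subseteq> (\<lambda>(x, y). lp_dist p x y) ` (X \<times> X)" by (auto simp: D_def)
    then have finD: "finite D" using X(1) by (meson finite_SigmaI finite_imageI finite_subset)
    obtain u v where "u \<in> X" "v \<in> X" "u \<noteq> v"
      using X by (metis card_le_Suc0_iff_eq not_less_eq_eq numeral_2_eq_2)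
    then have "lp_dist p u v \<in> D" unfolding D_def by blast
    then have neD: "D \<noteq> {}" by blast
    have sep: "Min D \<le> lp_dist p x y" "lp_dist p x y \<le> Max D" if "x \<in> X" "y \<in> X" "x \<noteq> y" for x y
    proof -
      have "lp_dist p x y \<in> D" unfolding D_def using that by blast
      then show "Min D \<le> lp_dist p x y" "lp_dist p x y \<le> Max D" using finD by simp_all
    qed
    obtain x y where "x \<in> X" "y \<in> X" "x \<noteq> y" "Min D = lp_dist p x y"
      using Min_in[OF finD neD] unfolding D_def by blast
    then have pos: "0 < Min D" by simp
    have "Min D \<le> Max D" using finD neD by (meson Min_in Max_ge)
    then have "1 \<le> Max D / Min D" using pos by simp
    have diam: "lp_dist p x y \<le> Max D" if "x \<in> X" "y \<in> X" for x y
      using sep(2)[OF that] that pos \<open>Min D \<le> Max D\<close> by (cases "x = y") auto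
    define L where "L = ln (real (card X) * (Max D / Min D))"
    \<comment> \<open>There are at least two points and the spread is at least 1.\<close>
    have "2 * 1 \<le> real (card X) * (Max D / Min D)"
      using X(2) \<open>1 \<le> Max D / Min D\<close> by (intro mult_mono) auto
    then have L2: "ln 2 \<le> L" unfolding L_def by (subst ln_le_cancel_iff) auto
    have "0 < ln (2 :: real)" by simp
    then have L0: "0 \<le> L" and L1: "1 \<le> L / ln 2" using L2 by (linarith, simp)
    have main: "run m \<subseteq> X" "card (run m) = k" "real m \<le> A * real k * L + 1 + real k"
      using swap_iterations[OF st assms(1) k run pos sep(1) diam L_def L0] by (auto simp: A_def)
    have "3 * real k \<le> 3 * real k * (L / ln 2)"
      using mult_left_mono[OF L1, of "3 * real k"] by simp
    then have "real m + 1 \<le> A * real k * L + 3 * real k * (L / ln 2)"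
      using main(3) k by linarith
    also have "\<dots> = C * real k * L" by (simp add: C_def algebra_simps)
    finally have "real m + 1 \<le> C * real k * ln (real (card X) * spread (lp_dist p) X)"
      by (simp add: L_def spread_def D_def)
    moreover have "induced_clusterings (lp_dist p) X (run m) \<subseteq> optimal_clusterings (lp_dist p) X k"
      if "swap_stops (lp_dist p) X (run m)"
      using stable_swap_stops_opt[OF st assms(1) main(1,2) k that] by (auto simp: optimal_clusterings_def)
    ultimately show ?thesis by blast
  qed
  ultimately show ?thesis by blast
qed

end
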